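(* In the setting fixed in the context, let $\tilde c:\mathbb{R}^n\times\mathbb{R}^m\times(0,1]\to\mathbb{R}$ be defined by the convolution $$\tilde c(z,\varepsilon)=\int_{\mathbb{R}^{n+m}}c(z-u)\psi_\varepsilon(u)\,du,\qquad z=(x,y),$$ and let $\mu>0$. If $\{(x^k,y^k)\}\subset X\times Y$ is a sequence such that, for each $k$, $(x^k,y^k)$ is a weak d-stationary point of $$\min_{x\in X}\max_{y\in Y}\ \tilde c(x,y,\varepsilon_k)+\lambda_1\sum_{i=1}^n\big(r(g_i(x_i),\mu)+r(g_{n+i}(x_i),\mu)\big)-\lambda_2\sum_{j=1}^m\big(r(h_j(y_j),\mu)+r(h_{m+j}(y_j),\mu)\big)$$ with $\varepsilon_k\downarrow0$, then any accumulation point of $\{(x^k,y^k)\}$ is a weak d-stationary point of $$\min_{x\in X}\max_{y\in Y}\ c(x,y)+\lambda_1\sum_{i=1}^n\big(r(g_i(x_i),\mu)+r(g_{n+i}(x_i),\mu)\big)-\lambda_2\sum_{j=1}^m\big(r(h_j(y_j),\mu)+r(h_{m+j}(y_j),\mu)\big).$$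
   Context: Notation. $[k]=\{1,\dots,k\}$; $e_i$ is the $i$-th standard unit vector; $t_+=\max\{t,0\}$; $\mathcal{N}_\Omega(x)$ is the normal cone of a closed convex set $\Omega$ at $x$; $\partial$ is the Clarke subdifferential ($\partial_x c(\bar x,\bar y)$ is that of $c(\cdot,\bar y)$ at $\bar x$, $\partial_y c(\bar x,\bar y)$ that of $c(\bar x,\cdot)$ at $\bar y$). Data. $c:\mathbb{R}^n\times\mathbb{R}^m\to\mathbb{R}$ is Lipschitz continuous, convex in $x$ for each $y$ and concave in $y$ for each $x$; $g_1,\dots,g_{2n},h_1,\dots,h_{2m}:\mathbb{R}\to\mathbb{R}$ are continuously differentiable and convex; $\lambda_1,\lambda_2>0$. $X=\tilde X\cap\bar X$ and $Y=\tilde Y\cap\bar Y$ have nonempty interior, where $\tilde X=\{x\in\mathbb{R}^n:\underline{\mathbf u}\le x\le\overline{\mathbf u}\}$, $\tilde Y=\{y\in\mathbb{R}^m:\underline{\mathbf v}\le y\le\overline{\mathbf v}\}$ with $\underline{\mathbf u}<\overline{\mathbf u}$, $\underline{\mathbf v}<\overline{\mathbf v}$ (componentwise), and $\bar X=\{x:u_t(x)\le0,\ t\in[\bar n]\}$, $\bar Y=\{y:v_s(y)\le0,\ s\in[\bar m]\}$ with Lipschitz continuous convex functions $u_t:\mathbb{R}^n\to\mathbb{R}$, $v_s:\mathbb{R}^m\to\mathbb{R}$. Put $\tilde X_i=[\underline{\mathbf u}_i,\overline{\mathbf u}_i]$, $\tilde Y_j=[\underline{\mathbf v}_j,\overline{\mathbf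 v}_j]$, $\mathcal{T}_0(x)=\{t:u_t(x)=0\}$, $\mathcal{S}_0(y)=\{s:v_s(y)=0\}$. Structural condition (standing assumption): there are constants $\tau,\sigma>0$ such that (i) for any $x\in X$, $i\in[n]$ and $(\hat i,\check i)\in\{(i,n+i),(n+i,i)\}$, if $g_{\hat i}(x_i)\in(0,\tau)$ then $x_i\in\mathrm{int}(\tilde X_i)$, $g_{\check i}(x_i)\notin[0,\tau]$, $|g_{\hat i}'(x_i)|\ge\sigma$, and $\xi_i\,g_{\hat i}'(x_i)\ge0$ for all $\xi\in\partial u_t(x)$, $t\in\mathcal{T}_0(x)$; (ii) for any $y\in Y$, $j\in[m]$ and $(\hat j,\check j)\in\{(j,m+j),(m+j,j)\}$, if $h_{\hat j}(y_j)\in(0,\tau)$ then $y_j\in\mathrm{int}(\tilde Y_j)$, $h_{\check j}(y_j)\notin[0,\tau]$, $|h_{\hat j}'(y_j)|\ge\sigma$, and $\eta_j\,h_{\hat j}'(y_j)\ge0$ for all $\eta\in\partial v_s(y)$, $s\in\mathcal{S}_0(y)$. Relaxation function: $r(t,\mu)=t_+/\mu-(t-\mu)_+/\mu$ (obtained from the uniform density on $[0,1]$). Mollifiers. $\psi_\varepsilon:\mathbb{R}^{n+m}\to[0,+\infty)$, $\varepsilon\in(0,1]$, are bounded measurable functions with $\int_{\mathbb{R}^{n+m}}\psi_\varepsilon(u)\,du=1$ such that the sets $B^\varepsilon=\{u:\psi_\varepsilon(u)>0\}$ are bounded and converge to $\{0\}$ as $\varepsilon\downarrow0$ (i.e. $\sup_{u\in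 B^\varepsilon}\|u\|\to0$). Weak d-stationarity. Let $\varpi_1(t)=t$, $\varpi_2(t)=0$, $\varpi(t)=\max\{\varpi_1(t),\varpi_2(t)\}$ and $\mathcal{D}(t)=\{d\in\{1,2\}:\varpi(t)=\varpi_d(t)\}$; thus $\varpi_1'=1$, $\varpi_2'=0$ and $\partial\varpi(t)$ is $\{1\}$, $[0,1]$, $\{0\}$ for $t>0$, $t=0$, $t<0$ respectively. For a convex-concave locally Lipschitz function $C$ (here $C=c$ or $C=\tilde c(\cdot,\cdot,\varepsilon_k)$), $(x^*,y^* )\in X\times Y$ is a weak d-stationary point of $$\min_{x\in X}\max_{y\in Y}\ C(x,y)+\lambda_1\sum_{i=1}^n\big(r(g_i(x_i),\mu)+r(g_{n+i}(x_i),\mu)\big)-\lambda_2\sum_{j=1}^m\big(r(h_j(y_j),\mu)+r(h_{m+j}(y_j),\mu)\big)$$ if there exist $q^*_{k}\in\mathcal{D}(g_{k}(x_i^* )-\mu)$ ($k\in\{i,n+i\}$, $i\in[n]$) and $p^*_{k}\in\mathcal{D}(h_{k}(y_j^* )-\mu)$ ($k\in\{j,m+j\}$, $j\in[m]$) such that $$\frac{\lambda_1}{\mu}\sum_{i=1}^n\big(\varpi_{q_i^*}'\,g_i'(x_i^* )+\varpi_{q_{n+i}^*}'\,g_{n+i}'(x_i^* )\big)e_i\in\partial_x C(x^*,y^* )+\frac{\lambda_1}{\mu}\sum_{i=1}^n\big(\partial\varpi(g_i(x_i^* ))g_i'(x_i^* )+\partial\varpi(g_{n+i}(x_i^* ))g_{n+i}'(x_i^*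 )\big)e_i+\mathcal{N}_X(x^* ),$$ $$\frac{\lambda_2}{\mu}\sum_{j=1}^m\big(\varpi_{p_j^*}'\,h_j'(y_j^* )+\varpi_{p_{m+j}^*}'\,h_{m+j}'(y_j^* )\big)e_j\in-\partial_y C(x^*,y^* )+\frac{\lambda_2}{\mu}\sum_{j=1}^m\big(\partial\varpi(h_j(y_j^* ))h_j'(y_j^* )+\partial\varpi(h_{m+j}(y_j^* ))h_{m+j}'(y_j^* )\big)e_j+\mathcal{N}_Y(y^* ).$$ *)

theory Defs
  imports "HOL-Analysis.Analysis"
begin

text \<open>Clarke's generalized directional derivative; it is finite wherever \<open>f\<close> is locally
  Lipschitz, which is the only case in which the theory below uses it.\<close>

definition clarke_dd :: "('a::euclidean_space \<Rightarrow> real) \<Rightarrow> 'a \<Rightarrow> 'a \<Rightarrow> ereal" where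
  "clarke_dd f x v =
     Limsup (nhds x \<times>\<^sub>F at_right 0) (\<lambda>(w, t). ereal ((f (w + t *\<^sub>R v) - f w) / t))"

definition clarke_subdiff :: "('a::euclidean_space \<Rightarrow> real) \<Rightarrow> 'a \<Rightarrow> 'a set" where
  "clarke_subdiff f x = {\<xi>. \<forall>v. ereal (\<xi> \<bullet> v) \<le> clarke_dd f x v}"

definition normal_cone :: "'a::euclidean_space set \<Rightarrow> 'a \<Rightarrow> 'a set" where
  "normal_cone \<Omega> x = (if x \<in> \<Omega> then {v. \<forall>z\<in>\<Omega>. v \<bullet> (z - x) \<le> 0} else {})"

definition box_constraints ::
    "real^'n \<Rightarrow> real^'n \<Rightarrow> nat \<Rightarrow> (nat \<Rightarrow> real^'n \<Rightarrow> real) \<Rightarrow> (real^'n) set" where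
  "box_constraints lo up N u = {x. \<forall>i. lo $ i \<le> x $ i \<and> x $ i \<le> up $ i}
                               \<inter> {x. \<forall>t\<in>{1..N}. u t x \<le> 0}"

text \<open>The \<open>2n\<close> functions \<open>g\<^sub>1, \<dots>, g\<^sub>2\<^sub>n\<close> are indexed by the sum type: \<open>g (Inl i)\<close> is
  \<open>g\<^sub>i\<close> and \<open>g (Inr i)\<close> is the function with index \<open>n + i\<close>. The two conditions of the structural
  assumption have the same form; this is the one for a single block of variables.\<close>

definition structural_condition ::
    "real^'n \<Rightarrow> real^'n \<Rightarrow> nat \<Rightarrow> (nat \<Rightarrow> real^'n \<Rightarrow> real) \<Rightarrow> ('n + 'n \<Rightarrow> real \<Rightarrow> real)
      \<Rightarrow> real \<Rightarrow> real \<Rightarrow> bool" where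
  "structural_condition lo up N u g \<tau> \<sigma> \<longleftrightarrow>
     (\<forall>x\<in>box_constraints lo up N u. \<forall>i. \<forall>(a, b)\<in>{(Inl i, Inr i), (Inr i, Inl i)}.
        g a (x $ i) \<in> {0<..<\<tau>} \<longrightarrow>
          x $ i \<in> interior {lo $ i..up $ i} \<and>
          g b (x $ i) \<notin> {0..\<tau>} \<and>
          \<bar>deriv (g a) (x $ i)\<bar> \<ge> \<sigma> \<and>
          (\<forall>t\<in>{1..N}. u t x = 0 \<longrightarrow>
             (\<forall>\<xi>\<in>clarke_subdiff (u t) x. \<xi> $ i * deriv (g a) (x $ i) \<ge> 0)))"

definition varpi_piece :: "nat \<Rightarrow> real \<Rightarrow> real" where
  "varpi_piece d t = (if d = 1 then t else 0)"

definition varpi :: "real \<Rightarrow> real" where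
  "varpi t = max (varpi_piece 1 t) (varpi_piece 2 t)"

definition active_pieces :: "real \<Rightarrow> nat set" where
  "active_pieces t = {d \<in> {1, 2}. varpi t = varpi_piece d t}"

definition relax :: "real \<Rightarrow> real \<Rightarrow> real" where
  "relax t \<mu> = max t 0 / \<mu> - max (t - \<mu>) 0 / \<mu>"

text \<open>Stationarity of the relaxed problem is expressed through this
  difference-of-convex decomposition: the minuend enters by \<open>\<partial>\<varpi>\<close>, the subtrahend
  by the derivative of one active piece.\<close>

lemma relax_eq_varpi: "relax t \<mu> = (varpi t - varpi (t - \<mu>)) / \<mu>"
  by (simp add: relax_def varpi_def varpi_piece_def diff_divide_distrib)

lemma deriv_varpi_piece:
  "deriv (varpi_piece 1) t = 1" "deriv (varpi_piece 2) t = 0"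
  by (auto simp: varpi_piece_def[abs_def])

lemma clarke_dd_varpi:
  "clarke_dd varpi t v = ereal (if t > 0 then v else if t < 0 then 0 else max v 0)"
proof -
  let ?F = "nhds t \<times>\<^sub>F at_right (0::real)"
  let ?f = "\<lambda>(w, s). ereal ((varpi (w + s *\<^sub>R v) - varpi w) / s)"
  let ?r = "if t > 0 then v else if t < 0 then 0 else max v 0"
  have vp: "varpi w = max w 0" for w
    by (simp add: varpi_def varpi_piece_def)
  have nb: "?F \<noteq> bot"
    by (simp add: prod_filter_eq_bot)
  have fst: "filterlim fst (nhds t) ?F"
    by (rule filterlim_fst)
  have "filterlim snd (at_right 0) ?F"
    by (rule filterlim_snd)
  then have pos: "\<forall>\<^sub>F z in ?F. snd z > 0" and snd: "filterlim snd (nhds 0) ?F"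
    by (auto simp: filterlim_at elim: eventually_mono)
  have lim: "filterlim (\<lambda>z. fst z + snd z * v) (nhds t) ?F"
    using tendsto_add[OF fst tendsto_mult_right[OF snd, of v]] by simp
  have upper: "\<forall>\<^sub>F z in ?F. ?f z \<le> ereal ?r"
  proof (cases t "0::real" rule: linorder_cases)
    case less
    have "\<forall>\<^sub>F z in ?F. fst z < 0" "\<forall>\<^sub>F z in ?F. fst z + snd z * v < 0"
      using order_tendstoD(2)[OF fst less] order_tendstoD(2)[OF lim less] by auto
    then show ?thesis
      by eventually_elim (use less in \<open>auto simp: vp\<close>)
  next
    case greater
    have "\<forall>\<^sub>F z in ?F. fst z > 0" "\<forall>\<^sub>F z in ?F. fst z + snd z * v > 0"
      using order_tendstoD(1)[OF fst greater] order_tendstoD(1)[OF lim greater] by auto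
    then show ?thesis
      using pos by eventually_elim (use greater in \<open>auto simp: vp\<close>)
  next
    case equal
    have "(varpi (w + s * v) - varpi w) / s \<le> max v 0" if "s > 0" for w s
    proof -
      have "s * v \<le> s * max v 0" and "0 \<le> s * max v 0"
        using that by (auto intro: mult_left_mono)
      then have "varpi (w + s * v) - varpi w \<le> max v 0 * s"
        unfolding vp mult.commute[of "max v 0"] by linarith
      then show ?thesis
        using that by (simp add: pos_divide_le_eq)
    qed
    then have "?f z \<le> ereal (max v 0)" if "snd z > 0" for z
      using that unfolding case_prod_unfold ereal_less_eq by simp
    then have "\<forall>\<^sub>F z in ?F. ?f z \<le> ereal (max v 0)"
      using pos by (rule eventually_mono[rotated])
    then show ?thesis
      unfolding equal by (simp only: less_irrefl if_False)
  qed
  have "ereal ?r \<le> Limsup ?F ?f"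
  proof (rule ccontr)
    assume "\<not> ?thesis"
    then have "\<forall>\<^sub>F z in ?F. ?f z < ereal ?r"
      by (intro Limsup_lessD) simp
    then obtain P Q where P: "eventually P (nhds t)" and Q: "eventually Q (at_right (0::real))"
      and PQ: "\<And>w s. P w \<Longrightarrow> Q s \<Longrightarrow> ?f (w, s) < ereal ?r"
      unfolding eventually_prod_filter by auto
    have "((\<lambda>s. t + s * v) \<longlongrightarrow> t + 0 * v) (at_right 0)"
      by (intro tendsto_intros)
    then have tv: "((\<lambda>s. t + s * v) \<longlongrightarrow> t) (at_right 0)"
      by simp
    have "\<forall>\<^sub>F s in at_right 0. (t > 0 \<longrightarrow> t + s * v > 0) \<and> (t < 0 \<longrightarrow> t + s * v < 0)"
      using order_tendstoD[OF tv] by (cases t "0::real" rule: linorder_cases) auto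
    then have "\<forall>\<^sub>F s in at_right 0. Q s \<and> s > 0 \<and>
        (t > 0 \<longrightarrow> t + s * v > 0) \<and> (t < 0 \<longrightarrow> t + s * v < 0)"
      using Q eventually_at_right_less[of "0::real"] by eventually_elim auto
    then obtain s where s: "Q s" "s > 0" "t > 0 \<longrightarrow> t + s * v > 0" "t < 0 \<longrightarrow> t + s * v < 0"
      by (metis (no_types, lifting) eventually_happens trivial_limit_at_right_real)
    have "?f (t, s) = ereal ?r"
      using s by (auto simp: vp max_def zero_le_mult_iff mult_le_0_iff)
    then show False
      using PQ[OF eventually_nhds_x_imp_x[OF P] s(1)] by simp
  qed
  then show ?thesis
    unfolding clarke_dd_def by (intro antisym Limsup_bounded upper) auto
qed

lemma clarke_subdiff_varpi:
  "clarke_subdiff varpi t = (if t > 0 then {1} else if t < 0 then {0} else {0..1})"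
proof -
  have "(\<forall>v. \<xi> * v \<le> v) \<longleftrightarrow> \<xi> = 1" for \<xi> :: real
    using spec[of "\<lambda>v. \<xi> * v \<le> v" 1] spec[of "\<lambda>v. \<xi> * v \<le> v" "-1"] by fastforce
  moreover have "(\<forall>v. \<xi> * v \<le> 0) \<longleftrightarrow> \<xi> = 0" for \<xi> :: real
    using spec[of "\<lambda>v. \<xi> * v \<le> 0" 1] spec[of "\<lambda>v. \<xi> * v \<le> 0" "-1"] by fastforce
  moreover have "(\<forall>v. \<xi> * v \<le> max v 0) \<longleftrightarrow> \<xi> \<in> {0..1}" for \<xi> :: real
  proof
    assume "\<forall>v. \<xi> * v \<le> max v 0"
    from spec[OF this, of 1] spec[OF this, of "-1"] show "\<xi> \<in> {0..1}" by simp
  next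
    assume "\<xi> \<in> {0..1}"
    then show "\<forall>v. \<xi> * v \<le> max v 0"
      by (auto simp: max_def mult_left_le_one_le mult_nonneg_nonpos)
  qed
  ultimately show ?thesis
    unfolding clarke_subdiff_def clarke_dd_varpi by auto
qed

fun coord :: "'n + 'n \<Rightarrow> 'n" where
  "coord (Inl i) = i"
| "coord (Inr i) = i"

definition weighted_gradient ::
    "('n + 'n \<Rightarrow> real \<Rightarrow> real) \<Rightarrow> ('n + 'n \<Rightarrow> real) \<Rightarrow> real^'n \<Rightarrow> real^'n" where
  "weighted_gradient g w x =
     (\<Sum>i\<in>UNIV. (w (Inl i) * deriv (g (Inl i)) (x $ i) + w (Inr i) * deriv (g (Inr i)) (x $ i))
                *\<^sub>R axis i 1)"

text \<open>The inclusion for one block of variables; \<open>A\<close> stands for \<open>\<partial>\<^sub>x C\<close> or \<open>-\<partial>\<^sub>y C\<close>, and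
  \<open>q\<close> for the chosen active pieces. The sums on the right are Minkowski sums.\<close>

definition stationarity_inclusion ::
    "(real^'n) set \<Rightarrow> (real^'n) set \<Rightarrow> ('n + 'n \<Rightarrow> real \<Rightarrow> real) \<Rightarrow> real \<Rightarrow> real
      \<Rightarrow> ('n + 'n \<Rightarrow> nat) \<Rightarrow> real^'n \<Rightarrow> bool" where
  "stationarity_inclusion A \<Omega> g lam \<mu> q x \<longleftrightarrow>
     (lam / \<mu>) *\<^sub>R weighted_gradient g
        (\<lambda>a. deriv (varpi_piece (q a)) (g a (x $ coord a) - \<mu>)) x
     \<in> A
       + {(lam / \<mu>) *\<^sub>R weighted_gradient g w x | w.
            \<forall>a. w a \<in> clarke_subdiff varpi (g a (x $ coord a))}
       + normal_cone \<Omega> x"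

definition weak_d_stationary ::
    "((real^'n) \<times> (real^'m) \<Rightarrow> real) \<Rightarrow> (real^'n) set \<Rightarrow> (real^'m) set
      \<Rightarrow> ('n + 'n \<Rightarrow> real \<Rightarrow> real) \<Rightarrow> ('m + 'm \<Rightarrow> real \<Rightarrow> real) \<Rightarrow> real \<Rightarrow> real \<Rightarrow> real
      \<Rightarrow> (real^'n) \<times> (real^'m) \<Rightarrow> bool" where
  "weak_d_stationary C X Y g h lam1 lam2 \<mu> = (\<lambda>(x, y).
     x \<in> X \<and> y \<in> Y \<and>
     (\<exists>q p. (\<forall>a. q a \<in> active_pieces (g a (x $ coord a) - \<mu>)) \<and>
            (\<forall>b. p b \<in> active_pieces (h b (y $ coord b) - \<mu>)) \<and>
            stationarity_inclusion (clarke_subdiff (\<lambda>x'. C (x', y)) x) X g lam1 \<mu> q x \<and>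
            stationarity_inclusion (uminus ` clarke_subdiff (\<lambda>y'. C (x, y')) y) Y h lam2 \<mu> p y))"

definition mollifier_family :: "(real \<Rightarrow> 'a::euclidean_space \<Rightarrow> real) \<Rightarrow> bool" where
  "mollifier_family \<psi> \<longleftrightarrow>
     (\<forall>\<epsilon>\<in>{0<..1}. (\<forall>u. 0 \<le> \<psi> \<epsilon> u) \<and> bounded (range (\<psi> \<epsilon>)) \<and> \<psi> \<epsilon> \<in> borel_measurable lebesgue \<and>
        (LINT u|lebesgue. \<psi> \<epsilon> u) = 1 \<and> bounded {u. \<psi> \<epsilon> u > 0}) \<and>
     ((\<lambda>\<epsilon>. SUP u\<in>{u. \<psi> \<epsilon> u > 0}. norm u) \<longlongrightarrow> 0) (at_right 0)"

definition mollify ::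
    "('a::euclidean_space \<Rightarrow> real) \<Rightarrow> (real \<Rightarrow> 'a \<Rightarrow> real) \<Rightarrow> real \<Rightarrow> 'a \<Rightarrow> real" where
  "mollify c \<psi> \<epsilon> z = (LINT u|lebesgue. c (z - u) * \<psi> \<epsilon> u)"

end

theory Submission
  imports Defs
begin

text \<open>
  Each of the two stationarity inclusions places a weighted gradient of the
  functions \<open>g\<close> or \<open>h\<close> in a Minkowski sum \<open>\<partial>F\<^sub>k + W + N\<close>, where \<open>F\<^sub>k\<close> is convex (for the second block,
  \<open>F\<^sub>k = -C\<^sub>k(x\<^sup>k, \<cdot>)\<close>), \<open>W\<close> collects the gradients weighted by \<open>\<partial>\<varpi>\<close>, and \<open>N\<close> is a
  normal cone. The proof is a closed-graph argument for this inclusion.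

  The summands are extracted along the sequence and a subsequence is chosen on which all of them converge.
  The mollified functions inherit the Lipschitz constant \<open>L\<close> of \<open>c\<close>, so their subgradients are
  bounded by \<open>L\<close>; the weights lie in \<open>[0, 1]\<close>; the chosen active pieces range over a finite set
  and may be taken constant. The normal vector is the difference of the other terms and therefore
  converges with them.

  Each summand passes to the limit. The inequalities defining the normal cone of a closed set are stable.
  For a convex function the Clarke subdifferential is the set of subgradients, described by
  the inequality \<open>F x + \<xi> \<bullet> (z - x) \<le> F z\<close>, which survives pointwise limits
  (\<open>clarke_subdiff_limit\<close>); this serves for \<open>\<partial>\<varpi>\<close> as well as for \<open>\<partial>C\<close>. Mollification preserves
  convexity in one block and concavity in the other, and moves \<open>c\<close> by at most \<open>L\<close> times the
  radius of the support, which tends to \<open>0\<close> (\<open>mollify_dist_le\<close>).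
\<close>

section \<open>Clarke subdifferentials of convex functions\<close>

text \<open>For a convex function the difference quotients along \<open>v\<close> increase with the step, so those
  with step below \<open>1\<close> are at most \<open>f (w + v) - f w\<close>; letting \<open>w\<close> tend to \<open>x\<close> bounds the Clarke derivative by
  \<open>f (x + v) - f x\<close>.\<close>

lemma clarke_dd_convex_le:
  fixes f :: "'a::euclidean_space \<Rightarrow> real"
  assumes "convex_on UNIV f"
  shows "clarke_dd f x v \<le> ereal (f (x + v) - f x)"
proof -
  let ?F = "nhds x \<times>\<^sub>F at_right (0::real)"
  have nb: "?F \<noteq> bot"
    by (simp add: prod_filter_eq_bot)
  have fst: "filterlim fst (nhds x) ?F"
    by (rule filterlim_fst)
  have "filterlim snd (at_right 0) ?F"
    by (rule filterlim_snd)
  then have pos: "\<forall>\<^sub>F z in ?F. snd z > 0" and snd: "filterlim snd (nhds 0) ?F"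
    by (auto simp: filterlim_at elim: eventually_mono)
  have small: "\<forall>\<^sub>F z in ?F. snd z < 1"
    using order_tendstoD(2)[OF snd, of 1] by simp
  have quot: "(f (w + t *\<^sub>R v) - f w) / t \<le> f (w + v) - f w" if "0 < t" "t < 1" for w t
  proof -
    have eq: "(1 - t) *\<^sub>R w + t *\<^sub>R (w + v) = w + t *\<^sub>R v"
      by (simp add: algebra_simps)
    have "f ((1 - t) *\<^sub>R w + t *\<^sub>R (w + v)) \<le> (1 - t) * f w + t * f (w + v)"
      using convex_onD[OF assms] that by auto
    then show ?thesis
      using that unfolding eq by (simp add: field_simps)
  qed
  have "isCont f y" for y
    using convex_on_continuous[OF open_UNIV assms] by (simp add: continuous_on_eq_continuous_at)
  then have "filterlim (\<lambda>z. f (fst z + v) - f (fst z)) (nhds (f (x + v) - f x)) ?F"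
    by (intro tendsto_diff isCont_tendsto_compose[of _ f] tendsto_add fst tendsto_const)
  then have lim: "filterlim (\<lambda>z. ereal (f (fst z + v) - f (fst z)))
      (nhds (ereal (f (x + v) - f x))) ?F"
    by (rule tendsto_ereal)
  have "clarke_dd f x v \<le> Limsup ?F (\<lambda>z. ereal (f (fst z + v) - f (fst z)))"
    unfolding clarke_dd_def
    using pos small
    by (intro Limsup_mono, eventually_elim) (auto simp: case_prod_unfold quot)
  then show ?thesis
    using lim_imp_Limsup[OF nb lim] by simp
qed

lemma subgradient_if_clarke:
  fixes f :: "'a::euclidean_space \<Rightarrow> real"
  assumes "convex_on UNIV f" and "\<xi> \<in> clarke_subdiff f x"
  shows "f x + \<xi> \<bullet> (z - x) \<le> f z"
proof -
  have "ereal (\<xi> \<bullet> (z - x)) \<le> clarke_dd f x (z - x)"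
    using assms(2) by (simp add: clarke_subdiff_def)
  also have "\<dots> \<le> ereal (f (x + (z - x)) - f x)"
    by (rule clarke_dd_convex_le[OF assms(1)])
  finally show ?thesis by simp
qed

text \<open>The quotients with base point exactly \<open>x\<close> already dominate \<open>\<xi> \<bullet> v\<close>, and the upper limit
  over nearby base points can only be larger.\<close>

lemma clarke_if_subgradient:
  fixes f :: "'a::euclidean_space \<Rightarrow> real"
  assumes sub: "\<And>z. f x + \<xi> \<bullet> (z - x) \<le> f z"
  shows "\<xi> \<in> clarke_subdiff f x"
  unfolding clarke_subdiff_def
proof (intro CollectI allI, rule ccontr)
  fix v
  assume "\<not> ereal (\<xi> \<bullet> v) \<le> clarke_dd f x v"
  then have "\<forall>\<^sub>F (w, t) in nhds x \<times>\<^sub>F at_right 0. ereal ((f (w + t *\<^sub>R v) - f w) / t) < ereal (\<xi> \<bullet> v)"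
    unfolding clarke_dd_def case_prod_unfold by (intro Limsup_lessD) simp
  then obtain P Q where P: "eventually P (nhds x)" and Q: "eventually Q (at_right (0::real))"
    and PQ: "\<And>w t. P w \<Longrightarrow> Q t \<Longrightarrow> (f (w + t *\<^sub>R v) - f w) / t < \<xi> \<bullet> v"
    unfolding eventually_prod_filter by auto
  have "\<forall>\<^sub>F t in at_right 0. Q t \<and> t > 0"
    using Q eventually_at_right_less[of "0::real"] by eventually_elim auto
  then obtain t where t: "Q t" "t > 0"
    by (metis (no_types, lifting) eventually_happens trivial_limit_at_right_real)
  have "(f (x + t *\<^sub>R v) - f x) / t < \<xi> \<bullet> v"
    using PQ[OF eventually_nhds_x_imp_x[OF P] t(1)] .
  moreover have "f x + t * (\<xi> \<bullet> v) \<le> f (x + t *\<^sub>R v)"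
    using sub[of "x + t *\<^sub>R v"] by simp
  ultimately show False
    using t by (simp add: field_simps)
qed

text \<open>The subgradient inequality involves only values of the functions, so it passes to the limit
  and yields a subgradient of \<open>G\<close>, hence a Clarke subgradient.\<close>

lemma clarke_subdiff_limit:
  fixes F :: "nat \<Rightarrow> 'a::euclidean_space \<Rightarrow> real"
  assumes convex: "\<And>k. convex_on UNIV (F k)"
    and pointwise: "\<And>z. (\<lambda>k. F k z) \<longlonglongrightarrow> G z"
    and diagonal: "(\<lambda>k. F k (x k)) \<longlonglongrightarrow> G x0"
    and x: "x \<longlonglongrightarrow> x0" and \<xi>: "\<xi> \<longlonglongrightarrow> \<xi>0"
    and sub: "\<And>k. \<xi> k \<in> clarke_subdiff (F k) (x k)"
  shows "\<xi>0 \<in> clarke_subdiff G x0"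
proof (rule clarke_if_subgradient)
  fix z
  have "(\<lambda>k. F k (x k) + \<xi> k \<bullet> (z - x k)) \<longlonglongrightarrow> G x0 + \<xi>0 \<bullet> (z - x0)"
    by (intro tendsto_intros diagonal x \<xi>)
  then show "G x0 + \<xi>0 \<bullet> (z - x0) \<le> G z"
    using pointwise by (rule LIMSEQ_le) (auto intro: subgradient_if_clarke[OF convex sub])
qed

text \<open>The subgradient inequality is tested at the point \<open>x + \<xi>\<close>.\<close>

lemma norm_clarke_subgradient_le:
  fixes f :: "'a::euclidean_space \<Rightarrow> real"
  assumes "convex_on UNIV f" and lip: "L-lipschitz_on UNIV f" and "\<xi> \<in> clarke_subdiff f x"
  shows "norm \<xi> \<le> L"
proof (cases "\<xi> = 0")
  case True
  then show ?thesis using lipschitz_on_nonneg[OF lip] by simp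
next
  case False
  have "norm \<xi> * norm \<xi> = \<xi> \<bullet> (x + \<xi> - x)"
    by (simp add: power2_norm_eq_inner[symmetric] power2_eq_square)
  also have "\<dots> \<le> f (x + \<xi>) - f x"
    using subgradient_if_clarke[OF assms(1,3), of "x + \<xi>"] by simp
  also have "\<dots> \<le> L * norm \<xi>"
    using lipschitz_onD[OF lip, of "x + \<xi>" x] by (simp add: dist_norm)
  finally show ?thesis using False by simp
qed

text \<open>The substitution \<open>w \<mapsto> w + t v\<close> of the base point exchanges the two function values in the
  difference quotient and leaves the filter invariant.\<close>

lemma clarke_dd_uminus_le:
  "clarke_dd (\<lambda>x. - f x) x v \<le> clarke_dd f x (- v)"
proof -
  let ?F = "nhds x \<times>\<^sub>F at_right (0::real)"
  let ?T = "\<lambda>z. (fst z + snd z *\<^sub>R v, snd z)"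
  let ?g = "\<lambda>(w, t). ereal ((f (w + t *\<^sub>R (- v)) - f w) / t)"
  have fst: "filterlim fst (nhds x) ?F"
    by (rule filterlim_fst)
  have snd: "filterlim snd (at_right 0) ?F"
    by (rule filterlim_snd)
  then have "filterlim snd (nhds 0) ?F"
    by (auto simp: filterlim_at)
  then have "filterlim (\<lambda>z. fst z + snd z *\<^sub>R v) (nhds (x + 0 *\<^sub>R v)) ?F"
    by (intro tendsto_intros fst)
  then have "filterlim ?T ?F ?F"
    by (intro filterlim_Pair snd) simp
  then have "Limsup (filtermap ?T ?F) ?g \<le> Limsup ?F ?g"
    unfolding Limsup_def filterlim_def by (intro INF_superset_mono) (auto simp: le_filter_def)
  moreover have "clarke_dd (\<lambda>x. - f x) x v = Limsup ?F (\<lambda>z. ?g (?T z))"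
    unfolding clarke_dd_def by (simp add: case_prod_unfold)
  ultimately show ?thesis
    using Limsup_filtermap_ge[of ?F ?g ?T] unfolding clarke_dd_def by simp
qed

lemma clarke_dd_uminus:
  "clarke_dd (\<lambda>x. - f x) x v = clarke_dd f x (- v)"
  using clarke_dd_uminus_le[of f x v] clarke_dd_uminus_le[of "\<lambda>x. - f x" x "- v"] by simp

lemma clarke_subdiff_uminus:
  "clarke_subdiff (\<lambda>x. - f x) x = uminus ` clarke_subdiff f x"
proof -
  have *: "- \<xi> \<in> clarke_subdiff (\<lambda>x. - f x) x" if "\<xi> \<in> clarke_subdiff f x"
    for \<xi> and f :: "'a \<Rightarrow> real"
    unfolding clarke_subdiff_def
  proof (intro CollectI allI)
    fix v
    show "ereal (- \<xi> \<bullet> v) \<le> clarke_dd (\<lambda>x. - f x) x v"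
      using that unfolding clarke_subdiff_def clarke_dd_uminus
      by (metis (no_types, lifting) inner_minus_left inner_minus_right mem_Collect_eq)
  qed
  show ?thesis
  proof (intro set_eqI iffI)
    fix \<xi> assume "\<xi> \<in> clarke_subdiff (\<lambda>x. - f x) x"
    from *[OF this] have "- \<xi> \<in> clarke_subdiff f x" by simp
    then show "\<xi> \<in> uminus ` clarke_subdiff f x" by (force simp: image_iff)
  next
    fix \<xi> assume "\<xi> \<in> uminus ` clarke_subdiff f x"
    then show "\<xi> \<in> clarke_subdiff (\<lambda>x. - f x) x" using * by auto
  qed
qed

section \<open>Closed graphs of the remaining terms\<close>

lemma normal_cone_limit:
  assumes "closed \<Omega>" and x: "x \<longlonglongrightarrow> x0" and \<nu>: "\<nu> \<longlonglongrightarrow> \<nu>0"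
    and mem: "\<And>k. \<nu> k \<in> normal_cone \<Omega> (x k)"
  shows "\<nu>0 \<in> normal_cone \<Omega> x0"
proof -
  have "x k \<in> \<Omega>" and ineq: "z \<in> \<Omega> \<Longrightarrow> \<nu> k \<bullet> (z - x k) \<le> 0" for k z
    using mem[of k] by (auto simp: normal_cone_def split: if_splits)
  then have "x0 \<in> \<Omega>"
    using closed_sequentially[OF \<open>closed \<Omega>\<close>] x by blast
  moreover have "\<nu>0 \<bullet> (z - x0) \<le> 0" if "z \<in> \<Omega>" for z
  proof (rule LIMSEQ_le_const2)
    show "(\<lambda>k. \<nu> k \<bullet> (z - x k)) \<longlonglongrightarrow> \<nu>0 \<bullet> (z - x0)"
      by (intro tendsto_intros x \<nu>)
  qed (use ineq[OF that] in auto)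
  ultimately show ?thesis
    by (simp add: normal_cone_def)
qed

lemma varpi_eq_max: "varpi t = max t 0"
  by (simp add: varpi_def varpi_piece_def)

lemma clarke_subdiff_varpi_limit:
  assumes "t \<longlonglongrightarrow> t0" and "w \<longlonglongrightarrow> w0" and "\<And>k. w k \<in> clarke_subdiff varpi (t k)"
  shows "w0 \<in> clarke_subdiff varpi t0"
proof (rule clarke_subdiff_limit[where F = "\<lambda>_. varpi"])
  show "convex_on UNIV varpi"
  proof (rule convex_onI)
    fix s x y :: real
    assume s: "0 < s" "s < 1"
    have "(1 - s) * x \<le> (1 - s) * max x 0" "s * y \<le> s * max y 0"
      using s by (auto intro: mult_left_mono)
    moreover have "0 \<le> (1 - s) * max x 0" "0 \<le> s * max y 0"
      using s by auto
    ultimately show "varpi ((1 - s) *\<^sub>R x + s *\<^sub>R y) \<le> (1 - s) * varpi x + s * varpi y"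
      by (simp add: varpi_eq_max)
  qed simp
  show "(\<lambda>k. varpi (t k)) \<longlonglongrightarrow> varpi t0"
    unfolding varpi_eq_max by (intro tendsto_intros assms)
qed (use assms in auto)

lemma active_pieces_limit:
  assumes t: "t \<longlonglongrightarrow> t0" and "\<And>k. d \<in> active_pieces (t k)"
  shows "d \<in> active_pieces t0"
proof -
  have "d \<in> {1, 2}" and eq: "varpi (t k) = varpi_piece d (t k)" for k
    using assms(2)[of k] by (auto simp: active_pieces_def)
  moreover have "(\<lambda>k. varpi (t k)) \<longlonglongrightarrow> varpi t0"
    unfolding varpi_eq_max by (intro tendsto_intros t)
  moreover have "(\<lambda>k. varpi_piece d (t k)) \<longlonglongrightarrow> varpi_piece d t0"
    using t by (simp add: varpi_piece_def)
  ultimately show ?thesis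
    using LIMSEQ_unique unfolding active_pieces_def by fastforce
qed

lemma deriv_varpi_piece_eq: "deriv (varpi_piece d) t = (if d = 1 then 1 else 0)"
  by (auto simp: varpi_piece_def[abs_def])

lemma continuous_deriv_if_C1:
  fixes f :: "real \<Rightarrow> real"
  assumes "f C1_differentiable_on UNIV"
  shows "continuous_on UNIV (deriv f)" and "continuous_on UNIV f"
proof -
  obtain D where D: "\<And>x. (f has_vector_derivative D x) (at x)" and cont: "continuous_on UNIV D"
    using assms unfolding C1_differentiable_on_def by auto
  have "deriv f = D"
    using D by (auto intro!: ext DERIV_imp_deriv simp: has_real_derivative_iff_has_vector_derivative)
  with cont show "continuous_on UNIV (deriv f)" by simp
  show "continuous_on UNIV f"
    using D by (meson continuous_at_imp_continuous_on has_vector_derivative_continuous)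
qed

lemma weighted_gradient_tendsto:
  assumes C1: "\<And>a. g a C1_differentiable_on UNIV"
    and x: "x \<longlonglongrightarrow> x0" and w: "\<And>a. (\<lambda>k. w k a) \<longlonglongrightarrow> w0 a"
  shows "(\<lambda>k. weighted_gradient g (w k) (x k)) \<longlonglongrightarrow> weighted_gradient g w0 x0"
proof -
  have "(\<lambda>k. deriv (g a) (x k $ i)) \<longlonglongrightarrow> deriv (g a) (x0 $ i)" for a i
    by (rule continuous_on_tendsto_compose[OF continuous_deriv_if_C1(1)[OF C1]])
      (auto intro!: tendsto_intros x)
  then show ?thesis
    unfolding weighted_gradient_def by (intro tendsto_intros w)
qed

section \<open>Limits of the stationarity inclusion\<close>

lemma constant_subsequence:
  fixes f :: "nat \<Rightarrow> 'b"
  assumes "finite (range f)"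
  obtains r :: "nat \<Rightarrow> nat" and b where "strict_mono r" and "\<And>k. f (r k) = b"
proof -
  obtain m where "infinite {k \<in> UNIV. f k = f m}"
    using pigeonhole_infinite[OF infinite_UNIV_nat assms] by auto
  from infinite_enumerate[OF this] obtain r :: "nat \<Rightarrow> nat" where "strict_mono r" and "\<And>k. f (r k) = f m"
    by auto
  then show ?thesis
    by (rule that)
qed

text \<open>The closed-graph property of the whole inclusion. Constancy of the active pieces, convergence of subgradients and weights, and hence
  convergence of the normal vectors are arranged on one subsequence.\<close>

lemma stationarity_inclusion_limit:
  fixes F :: "nat \<Rightarrow> real^'n \<Rightarrow> real" and g :: "'n + 'n \<Rightarrow> real \<Rightarrow> real"
  assumes convex: "\<And>k. convex_on UNIV (F k)"
    and lip: "\<And>k. L-lipschitz_on UNIV (F k)"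
    and pointwise: "\<And>z. (\<lambda>k. F k z) \<longlonglongrightarrow> G z"
    and C1: "\<And>a. g a C1_differentiable_on UNIV"
    and "closed \<Omega>" and x: "x \<longlonglongrightarrow> x0"
    and active: "\<And>k a. q k a \<in> active_pieces (g a (x k $ coord a) - \<mu>)"
    and incl: "\<And>k. stationarity_inclusion (clarke_subdiff (F k) (x k)) \<Omega> g lam \<mu> (q k) (x k)"
  shows "\<exists>q. (\<forall>a. q a \<in> active_pieces (g a (x0 $ coord a) - \<mu>)) \<and>
             stationarity_inclusion (clarke_subdiff G x0) \<Omega> g lam \<mu> q x0"
proof -
  have "range q \<subseteq> {f. \<forall>a. (a \<in> UNIV \<longrightarrow> f a \<in> {1, 2}) \<and> (a \<notin> UNIV \<longrightarrow> f a = 0)}"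
    using active by (fastforce simp: active_pieces_def)
  then have "finite (range q)"
    by (rule finite_subset) (intro finite_set_of_finite_funs, auto)
  then obtain r1 :: "nat \<Rightarrow> nat" and q0 where r1: "strict_mono r1" and q0: "\<And>k. q (r1 k) = q0"
    by (rule constant_subsequence) blast
  define \<theta> where "\<theta> = (\<lambda>a. if q0 a = 1 then 1 else 0 :: real)"
  have "\<exists>\<xi> w \<nu>. \<xi> \<in> clarke_subdiff (F (r1 k)) (x (r1 k)) \<and>
      (\<forall>a. w a \<in> clarke_subdiff varpi (g a (x (r1 k) $ coord a))) \<and>
      \<nu> \<in> normal_cone \<Omega> (x (r1 k)) \<and>
      (lam / \<mu>) *\<^sub>R weighted_gradient g \<theta> (x (r1 k))
        = \<xi> + (lam / \<mu>) *\<^sub>R weighted_gradient g w (x (r1 k)) + \<nu>" for k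
    using incl[of "r1 k"]
    unfolding stationarity_inclusion_def deriv_varpi_piece_eq q0 \<theta>_def[symmetric] set_plus_def
    by blast
  then obtain \<xi> w \<nu> where \<xi>: "\<And>k. \<xi> k \<in> clarke_subdiff (F (r1 k)) (x (r1 k))"
    and w: "\<And>k a. w k a \<in> clarke_subdiff varpi (g a (x (r1 k) $ coord a))"
    and \<nu>: "\<And>k. \<nu> k \<in> normal_cone \<Omega> (x (r1 k))"
    and eq: "\<And>k. (lam / \<mu>) *\<^sub>R weighted_gradient g \<theta> (x (r1 k))
        = \<xi> k + (lam / \<mu>) *\<^sub>R weighted_gradient g (w k) (x (r1 k)) + \<nu> k"
    by metis

  have "bounded (range \<xi>)"
    using norm_clarke_subgradient_le[OF convex lip \<xi>] by (auto simp: bounded_iff)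
  moreover have "bounded (range (\<lambda>k. \<chi> a. w k a))"
  proof -
    have "w k a \<in> {0..1}" for k a
      using w[of k a] by (auto simp: clarke_subdiff_varpi split: if_splits)
    then have "range (\<lambda>k. \<chi> a. w k a) \<subseteq> cbox 0 1"
      by (auto simp: mem_box_cart)
    then show ?thesis
      by (rule bounded_subset[OF bounded_cbox])
  qed
  ultimately have "bounded (range \<xi> \<times> range (\<lambda>k. \<chi> a. w k a))"
    by (rule bounded_Times)
  then have "bounded (range (\<lambda>k. (\<xi> k, \<chi> a. w k a)))"
    by (rule bounded_subset) auto
  from bounded_imp_convergent_subsequence[OF this]
  obtain l r2 where r2: "strict_mono r2"
    and l: "((\<lambda>k. (\<xi> k, \<chi> a. w k a)) \<circ> r2) \<longlonglongrightarrow> l"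
    by blast
  define r where "r = r1 \<circ> r2"
  define w0 where "w0 = (\<lambda>a. snd l $ a)"
  have r: "strict_mono r"
    unfolding r_def using r1 r2 by (rule strict_mono_o)
  have xr: "(\<lambda>k. x (r k)) \<longlonglongrightarrow> x0"
    using LIMSEQ_subseq_LIMSEQ[OF x r] by (simp add: o_def)
  have \<xi>lim: "(\<lambda>k. \<xi> (r2 k)) \<longlonglongrightarrow> fst l"
    using tendsto_fst[OF l] by (simp add: o_def)
  have wlim: "(\<lambda>k. w (r2 k) a) \<longlonglongrightarrow> w0 a" for a
    using tendsto_vec_nth[OF tendsto_snd[OF l], of a] by (simp add: o_def w0_def)
  have glim: "(\<lambda>k. g a (x (r k) $ coord a)) \<longlonglongrightarrow> g a (x0 $ coord a)" for a
    by (rule continuous_on_tendsto_compose[OF continuous_deriv_if_C1(2)[OF C1]])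
      (auto intro!: tendsto_intros xr)

  define \<nu>0 where "\<nu>0 = (lam / \<mu>) *\<^sub>R weighted_gradient g \<theta> x0 - fst l
      - (lam / \<mu>) *\<^sub>R weighted_gradient g w0 x0"
  have "\<nu> (r2 k) = (lam / \<mu>) *\<^sub>R weighted_gradient g \<theta> (x (r k)) - \<xi> (r2 k)
      - (lam / \<mu>) *\<^sub>R weighted_gradient g (w (r2 k)) (x (r k))" for k
    using eq[of "r2 k"] by (simp add: r_def)
  moreover have "(\<lambda>k. (lam / \<mu>) *\<^sub>R weighted_gradient g \<theta> (x (r k)) - \<xi> (r2 k)
      - (lam / \<mu>) *\<^sub>R weighted_gradient g (w (r2 k)) (x (r k))) \<longlonglongrightarrow> \<nu>0"
    unfolding \<nu>0_def
    by (intro tendsto_diff tendsto_scaleR tendsto_const weighted_gradient_tendsto C1 xr \<xi>lim wlim)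
  ultimately have \<nu>lim: "(\<lambda>k. \<nu> (r2 k)) \<longlonglongrightarrow> \<nu>0"
    by simp
  have normal: "\<nu>0 \<in> normal_cone \<Omega> x0"
    using \<open>closed \<Omega>\<close> xr \<nu>lim by (rule normal_cone_limit) (simp add: r_def \<nu>)

  have Fr: "(\<lambda>k. F (r k) z) \<longlonglongrightarrow> G z" for z
    using LIMSEQ_subseq_LIMSEQ[OF pointwise r] by (simp add: o_def)
  (* The common Lipschitz constant turns pointwise convergence into convergence along x. *)
  have "(\<lambda>k. F (r k) (x (r k)) - F (r k) x0) \<longlonglongrightarrow> 0"
  proof (rule Lim_null_comparison)
    show "(\<lambda>k. L * dist (x (r k)) x0) \<longlonglongrightarrow> 0"
      using tendsto_mult_right_zero[OF iffD1[OF tendsto_dist_iff xr]] .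
    show "\<forall>\<^sub>F k in sequentially. norm (F (r k) (x (r k)) - F (r k) x0) \<le> L * dist (x (r k)) x0"
      using lipschitz_onD[OF lip] by (auto simp: dist_real_def)
  qed
  from tendsto_add[OF this Fr[of x0]] have "(\<lambda>k. F (r k) (x (r k))) \<longlonglongrightarrow> G x0"
    by simp
  then have sub: "fst l \<in> clarke_subdiff G x0"
    by (rule clarke_subdiff_limit[OF convex Fr _ xr \<xi>lim]) (simp add: r_def \<xi>)
  have weights: "w0 a \<in> clarke_subdiff varpi (g a (x0 $ coord a))" for a
    using glim wlim by (rule clarke_subdiff_varpi_limit) (simp add: r_def w)
  have "q0 a \<in> active_pieces (g a (x0 $ coord a) - \<mu>)" for a
    by (rule active_pieces_limit[OF tendsto_diff[OF glim tendsto_const]])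
      (metis active q0 r_def o_apply)
  moreover have "(lam / \<mu>) *\<^sub>R weighted_gradient g \<theta> x0
      = fst l + (lam / \<mu>) *\<^sub>R weighted_gradient g w0 x0 + \<nu>0"
    by (simp add: \<nu>0_def)
  then have "stationarity_inclusion (clarke_subdiff G x0) \<Omega> g lam \<mu> q0 x0"
    unfolding stationarity_inclusion_def deriv_varpi_piece_eq \<theta>_def[symmetric] set_plus_def
    using sub weights normal by blast
  ultimately show ?thesis
    by blast
qed

section \<open>Mollification of Lipschitz functions\<close>

definition mollifier_radius :: "(real \<Rightarrow> 'a::euclidean_space \<Rightarrow> real) \<Rightarrow> real \<Rightarrow> real" where
  "mollifier_radius \<psi> \<epsilon> = (SUP u\<in>{u. \<psi> \<epsilon> u > 0}. norm u)"

context
  fixes \<psi> :: "real \<Rightarrow> 'a::euclidean_space \<Rightarrow> real" and \<epsilon> :: real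
  assumes family: "mollifier_family \<psi>" and eps: "\<epsilon> \<in> {0<..1}"
begin

lemma mollifier_nonneg: "0 \<le> \<psi> \<epsilon> u"
  and mollifier_measurable: "\<psi> \<epsilon> \<in> borel_measurable lebesgue"
  and mollifier_integral: "(LINT u|lebesgue. \<psi> \<epsilon> u) = 1"
  and mollifier_bounded_support: "bounded {u. \<psi> \<epsilon> u > 0}"
  using family eps unfolding mollifier_family_def by auto

text \<open>The Bochner integral of a function that is not integrable is \<open>0\<close>, not \<open>1\<close>.\<close>

lemma mollifier_integrable: "integrable lebesgue (\<psi> \<epsilon>)"
  using mollifier_integral not_integrable_integral_eq by fastforce

lemma norm_le_mollifier_radius: "\<psi> \<epsilon> u > 0 \<Longrightarrow> norm u \<le> mollifier_radius \<psi> \<epsilon>"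
  unfolding mollifier_radius_def
proof (rule cSUP_upper)
  show "bdd_above (norm ` {u. \<psi> \<epsilon> u > 0})"
    using mollifier_bounded_support unfolding bounded_iff bdd_above_def by blast
qed simp

text \<open>The increment \<open>c (z - u) - c z\<close> is controlled by the Lipschitz constant where \<open>\<psi> \<epsilon>\<close> is
  positive, while \<open>c (z - u)\<close> itself carries the size of \<open>c z\<close>. The same bound therefore serves
  both for integrability and for the distance between \<open>c\<close> and its mollification.\<close>

lemma mollify_integrand_bound:
  assumes lip: "L-lipschitz_on UNIV c"
  shows "\<bar>(c (z - u) - c z) * \<psi> \<epsilon> u\<bar> \<le> L * mollifier_radius \<psi> \<epsilon> * \<psi> \<epsilon> u"
proof (cases "\<psi> \<epsilon> u > 0")
  case True
  have "\<bar>c (z - u) - c z\<bar> \<le> L * norm u"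
    using lipschitz_onD[OF lip, of "z - u" z] by (simp add: dist_norm)
  also have "\<dots> \<le> L * mollifier_radius \<psi> \<epsilon>"
    using norm_le_mollifier_radius[OF True] lipschitz_on_nonneg[OF lip] by (rule mult_left_mono)
  finally show ?thesis
    using True by (simp add: abs_mult mult_right_mono)
next
  case False
  then have "\<psi> \<epsilon> u = 0"
    using mollifier_nonneg[of u] by linarith
  then show ?thesis by simp
qed

lemma mollify_increment_integrable:
  assumes lip: "L-lipschitz_on UNIV c"
  shows "integrable lebesgue (\<lambda>u. (c (z - u) - c z) * \<psi> \<epsilon> u)"
proof (rule Bochner_Integration.integrable_bound)
  show "integrable lebesgue (\<lambda>u. L * mollifier_radius \<psi> \<epsilon> * \<psi> \<epsilon> u)"
    by (intro integrable_mult_right mollifier_integrable)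
  have "continuous_on UNIV (\<lambda>u. c (z - u) - c z)"
    by (intro continuous_intros continuous_on_compose2[OF lipschitz_on_continuous_on[OF lip]]) auto
  then have "(\<lambda>u. c (z - u) - c z) \<in> borel_measurable lebesgue"
    by (intro measurable_completion) (simp add: borel_measurable_continuous_onI)
  then show "(\<lambda>u. (c (z - u) - c z) * \<psi> \<epsilon> u) \<in> borel_measurable lebesgue"
    by (intro borel_measurable_times mollifier_measurable)
  show "AE u in lebesgue. norm ((c (z - u) - c z) * \<psi> \<epsilon> u)
      \<le> norm (L * mollifier_radius \<psi> \<epsilon> * \<psi> \<epsilon> u)"
  proof (rule AE_I2)
    fix u
    show "norm ((c (z - u) - c z) * \<psi> \<epsilon> u) \<le> norm (L * mollifier_radius \<psi> \<epsilon> * \<psi> \<epsilon> u)"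
      using mollify_integrand_bound[OF lip, of z u] by simp
  qed
qed

lemma mollify_integrable:
  assumes lip: "L-lipschitz_on UNIV c"
  shows "integrable lebesgue (\<lambda>u. c (z - u) * \<psi> \<epsilon> u)"
proof -
  have "integrable lebesgue (\<lambda>u. (c (z - u) - c z) * \<psi> \<epsilon> u + c z * \<psi> \<epsilon> u)"
    by (intro Bochner_Integration.integrable_add mollify_increment_integrable[OF lip]
        integrable_mult_right mollifier_integrable)
  then show ?thesis by (simp add: algebra_simps)
qed

lemma mollify_dist_le:
  assumes lip: "L-lipschitz_on UNIV c"
  shows "\<bar>mollify c \<psi> \<epsilon> z - c z\<bar> \<le> L * mollifier_radius \<psi> \<epsilon>"
proof -
  have "mollify c \<psi> \<epsilon> z - c z
      = (LINT u|lebesgue. c (z - u) * \<psi> \<epsilon> u) - (LINT u|lebesgue. c z * \<psi> \<epsilon> u)"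
    by (simp add: mollify_def mollifier_integral)
  also have "\<dots> = (LINT u|lebesgue. c (z - u) * \<psi> \<epsilon> u - c z * \<psi> \<epsilon> u)"
    by (intro Bochner_Integration.integral_diff[symmetric] mollify_integrable[OF lip]
        integrable_mult_right mollifier_integrable)
  also have "\<dots> = (LINT u|lebesgue. (c (z - u) - c z) * \<psi> \<epsilon> u)"
    by (simp add: left_diff_distrib)
  finally have "\<bar>mollify c \<psi> \<epsilon> z - c z\<bar> = \<bar>LINT u|lebesgue. (c (z - u) - c z) * \<psi> \<epsilon> u\<bar>"
    by simp
  also have "\<dots> \<le> (LINT u|lebesgue. \<bar>(c (z - u) - c z) * \<psi> \<epsilon> u\<bar>)"
    by (rule integral_abs_bound)
  also have "\<dots> \<le> (LINT u|lebesgue. L * mollifier_radius \<psi> \<epsilon> * \<psi> \<epsilon> u)"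
    by (intro integral_mono integrable_abs mollify_increment_integrable[OF lip]
        integrable_mult_right mollifier_integrable mollify_integrand_bound[OF lip])
  finally show ?thesis
    by (simp add: mollifier_integral)
qed

lemma mollify_lipschitz:
  assumes lip: "L-lipschitz_on UNIV c"
  shows "L-lipschitz_on UNIV (mollify c \<psi> \<epsilon>)"
proof (rule lipschitz_onI)
  fix z z'
  have le: "mollify c \<psi> \<epsilon> a - mollify c \<psi> \<epsilon> b \<le> L * dist a b" for a b
  proof -
    have "mollify c \<psi> \<epsilon> a \<le> (LINT u|lebesgue. c (b - u) * \<psi> \<epsilon> u + L * dist a b * \<psi> \<epsilon> u)"
      unfolding mollify_def
    proof (intro integral_mono Bochner_Integration.integrable_add mollify_integrable[OF lip]
        integrable_mult_right mollifier_integrable)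
      fix u
      have "c (a - u) \<le> c (b - u) + L * dist a b"
        using lipschitz_onD[OF lip, of "a - u" "b - u"] by (simp add: dist_norm)
      from mult_right_mono[OF this mollifier_nonneg[of u]]
      show "c (a - u) * \<psi> \<epsilon> u \<le> c (b - u) * \<psi> \<epsilon> u + L * dist a b * \<psi> \<epsilon> u"
        by (simp add: distrib_right)
    qed
    also have "\<dots> = mollify c \<psi> \<epsilon> b + L * dist a b"
      by (subst Bochner_Integration.integral_add)
        (auto simp: mollify_def mollifier_integral
          intro!: mollify_integrable[OF lip] integrable_mult_right mollifier_integrable)
    finally show ?thesis by simp
  qed
  show "dist (mollify c \<psi> \<epsilon> z) (mollify c \<psi> \<epsilon> z') \<le> L * dist z z'"
    using le[of z z'] le[of z' z] by (simp add: dist_real_def dist_commute abs_le_iff)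
qed (rule lipschitz_on_nonneg[OF lip])

text \<open>The map \<open>T\<close> stands for the inclusion of one block of variables with the other one fixed; the
  mollified function is an average of translates of \<open>c\<close>, each convex along \<open>T\<close>.\<close>

lemma mollify_convex_along:
  fixes T :: "'b::real_vector \<Rightarrow> 'a"
  assumes lip: "L-lipschitz_on UNIV c"
    and convex: "\<And>u. convex_on UNIV (\<lambda>x. c (T x - u))"
  shows "convex_on UNIV (\<lambda>x. mollify c \<psi> \<epsilon> (T x))"
proof (rule convex_onI)
  fix t :: real and x y :: 'b
  assume t: "0 < t" "t < 1"
  let ?z = "(1 - t) *\<^sub>R x + t *\<^sub>R y"
  have "mollify c \<psi> \<epsilon> (T ?z) \<le> (LINT u|lebesgue.
      (1 - t) * (c (T x - u) * \<psi> \<epsilon> u) + t * (c (T y - u) * \<psi> \<epsilon> u))"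
    unfolding mollify_def
  proof (intro integral_mono Bochner_Integration.integrable_add mollify_integrable[OF lip]
      integrable_mult_right)
    fix u
    have "c (T ?z - u) \<le> (1 - t) * c (T x - u) + t * c (T y - u)"
      using convex_onD[OF convex[of u], of t x y] t by simp
    from mult_right_mono[OF this mollifier_nonneg[of u]]
    show "c (T ?z - u) * \<psi> \<epsilon> u
        \<le> (1 - t) * (c (T x - u) * \<psi> \<epsilon> u) + t * (c (T y - u) * \<psi> \<epsilon> u)"
      by (simp add: algebra_simps)
  qed
  also have "\<dots> = (1 - t) * mollify c \<psi> \<epsilon> (T x) + t * mollify c \<psi> \<epsilon> (T y)"
    unfolding mollify_def
    by (subst Bochner_Integration.integral_add)
      (simp_all add: mollify_integrable[OF lip] integrable_mult_right)
  finally show "mollify c \<psi> \<epsilon> (T ?z)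
      \<le> (1 - t) * mollify c \<psi> \<epsilon> (T x) + t * mollify c \<psi> \<epsilon> (T y)" .
qed simp

end

lemma mollify_uminus: "mollify (\<lambda>z. - c z) \<psi> \<epsilon> z = - mollify c \<psi> \<epsilon> z"
  by (simp add: mollify_def)

lemma mollify_tendsto:
  assumes family: "mollifier_family \<psi>" and lip: "L-lipschitz_on UNIV c"
    and eps: "\<And>k. \<epsilon> k \<in> {0<..1}" and "\<epsilon> \<longlonglongrightarrow> 0" and z: "z \<longlonglongrightarrow> z0"
  shows "(\<lambda>k. mollify c \<psi> (\<epsilon> k) (z k)) \<longlonglongrightarrow> c z0"
proof -
  have "filterlim \<epsilon> (at_right 0) sequentially"
    unfolding filterlim_at using \<open>\<epsilon> \<longlonglongrightarrow> 0\<close> eps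
    by (auto intro!: always_eventually simp: less_imp_neq[THEN not_sym])
  moreover have "(mollifier_radius \<psi> \<longlongrightarrow> 0) (at_right 0)"
    using family unfolding mollifier_family_def mollifier_radius_def[abs_def] by blast
  ultimately have "(\<lambda>k. mollifier_radius \<psi> (\<epsilon> k)) \<longlonglongrightarrow> 0"
    by (rule filterlim_compose[rotated])
  then have "(\<lambda>k. L * mollifier_radius \<psi> (\<epsilon> k)) \<longlonglongrightarrow> 0"
    by (rule tendsto_mult_right_zero)
  then have "(\<lambda>k. mollify c \<psi> (\<epsilon> k) (z k) - c (z k)) \<longlonglongrightarrow> 0"
    by (rule Lim_null_comparison[rotated]) (simp add: mollify_dist_le[OF family eps lip])
  moreover have "(\<lambda>k. c (z k)) \<longlonglongrightarrow> c z0"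
    using continuous_on_tendsto_compose[OF lipschitz_on_continuous_on[OF lip] z] by simp
  ultimately show ?thesis
    using tendsto_add by fastforce
qed

section \<open>Stability of weak d-stationary points\<close>

lemma convex_on_translate:
  assumes "convex_on UNIV f"
  shows "convex_on UNIV (\<lambda>x. f (x - a))"
proof (rule convex_onI)
  fix t :: real and x y
  assume "0 < t" "t < 1"
  moreover have "(1 - t) *\<^sub>R x + t *\<^sub>R y - a = (1 - t) *\<^sub>R (x - a) + t *\<^sub>R (y - a)"
    by (simp add: algebra_simps)
  ultimately show "f ((1 - t) *\<^sub>R x + t *\<^sub>R y - a) \<le> (1 - t) * f (x - a) + t * f (y - a)"
    using convex_onD[OF assms, of t "x - a" "y - a"] by simp
qed simp

lemma closed_box_constraints:
  assumes "\<And>t. t \<in> {1..N} \<Longrightarrow> \<exists>L. L-lipschitz_on UNIV (u t)"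
  shows "closed (box_constraints lo up N u)"
proof -
  have "continuous_on UNIV (u t)" if "t \<in> {1..N}" for t
    using assms[OF that] lipschitz_on_continuous_on by blast
  then have "closed (\<Inter>t\<in>{1..N}. {x. u t x \<le> 0})"
    by (intro closed_INT ballI closed_Collect_le continuous_on_const)
  moreover have "{x. \<forall>t\<in>{1..N}. u t x \<le> 0} = (\<Inter>t\<in>{1..N}. {x. u t x \<le> 0})"
    by auto
  ultimately have "closed {x. \<forall>t\<in>{1..N}. u t x \<le> 0}"
    by simp
  moreover have "{x. \<forall>i. lo $ i \<le> x $ i \<and> x $ i \<le> up $ i} = cbox lo up"
    by (auto simp: mem_box_cart)
  ultimately show ?thesis
    unfolding box_constraints_def by (auto intro: closed_Int)
qed

lemma lipschitz_on_Pair_slices: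
  assumes "L-lipschitz_on UNIV f"
  shows "L-lipschitz_on UNIV (\<lambda>x. f (x, b))" and "L-lipschitz_on UNIV (\<lambda>y. f (a, y))"
proof -
  show "L-lipschitz_on UNIV (\<lambda>x. f (x, b))"
    using lipschitz_onD[OF assms, of "(_, b)" "(_, b)"] lipschitz_on_nonneg[OF assms]
    by (intro lipschitz_onI) (simp_all add: dist_Pair_Pair)
  show "L-lipschitz_on UNIV (\<lambda>y. f (a, y))"
    using lipschitz_onD[OF assms, of "(a, _)" "(a, _)"] lipschitz_on_nonneg[OF assms]
    by (intro lipschitz_onI) (simp_all add: dist_Pair_Pair)
qed

theorem proposition5p5:
  fixes c :: "(real^'n) \<times> (real^'m) \<Rightarrow> real"
    and g :: "'n + 'n \<Rightarrow> real \<Rightarrow> real" and h :: "'m + 'm \<Rightarrow> real \<Rightarrow> real"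
    and lo\<^sub>x up\<^sub>x :: "real^'n" and lo\<^sub>y up\<^sub>y :: "real^'m"
    and nbar mbar :: nat
    and u :: "nat \<Rightarrow> real^'n \<Rightarrow> real" and v :: "nat \<Rightarrow> real^'m \<Rightarrow> real"
    and X :: "(real^'n) set" and Y :: "(real^'m) set"
    and lam1 lam2 \<tau> \<sigma> \<mu> :: real
    and \<psi> :: "real \<Rightarrow> (real^'n) \<times> (real^'m) \<Rightarrow> real"
    and xs :: "nat \<Rightarrow> real^'n" and ys :: "nat \<Rightarrow> real^'m" and \<epsilon> :: "nat \<Rightarrow> real"
    and xstar :: "real^'n" and ystar :: "real^'m"
  assumes c_lipschitz: "\<exists>L. L-lipschitz_on UNIV c"
    and c_convex: "\<And>y. convex_on UNIV (\<lambda>x. c (x, y))"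
    and c_concave: "\<And>x. concave_on UNIV (\<lambda>y. c (x, y))"
    and g_C1: "\<And>a. g a C1_differentiable_on UNIV"
    and g_convex: "\<And>a. convex_on UNIV (g a)"
    and h_C1: "\<And>b. h b C1_differentiable_on UNIV"
    and h_convex: "\<And>b. convex_on UNIV (h b)"
    and lambda_pos: "lam1 > 0" "lam2 > 0"
    and box_x: "\<And>i. lo\<^sub>x $ i < up\<^sub>x $ i"
    and box_y: "\<And>j. lo\<^sub>y $ j < up\<^sub>y $ j"
    and u_lipschitz: "\<And>t. t \<in> {1..nbar} \<Longrightarrow> \<exists>L. L-lipschitz_on UNIV (u t)"
    and u_convex: "\<And>t. t \<in> {1..nbar} \<Longrightarrow> convex_on UNIV (u t)"
    and v_lipschitz: "\<And>s. s \<in> {1..mbar} \<Longrightarrow> \<exists>L. L-lipschitz_on UNIV (v s)"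
    and v_convex: "\<And>s. s \<in> {1..mbar} \<Longrightarrow> convex_on UNIV (v s)"
    and X_def: "X = box_constraints lo\<^sub>x up\<^sub>x nbar u"
    and Y_def: "Y = box_constraints lo\<^sub>y up\<^sub>y mbar v"
    and X_interior: "interior X \<noteq> {}"
    and Y_interior: "interior Y \<noteq> {}"
    and tau_sigma_pos: "\<tau> > 0" "\<sigma> > 0"
    and structural_x: "structural_condition lo\<^sub>x up\<^sub>x nbar u g \<tau> \<sigma>"
    and structural_y: "structural_condition lo\<^sub>y up\<^sub>y mbar v h \<tau> \<sigma>"
    and mollifiers: "mollifier_family \<psi>"
    and mu_pos: "\<mu> > 0"
    and eps_range: "\<And>k. \<epsilon> k \<in> {0<..1}"
    and eps_tendsto: "\<epsilon> \<longlonglongrightarrow> 0"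
    and stationary:
      "\<And>k. weak_d_stationary (mollify c \<psi> (\<epsilon> k)) X Y g h lam1 lam2 \<mu> (xs k, ys k)"
    and accumulation:
      "\<exists>r. strict_mono r \<and> ((\<lambda>k. (xs k, ys k)) \<circ> r) \<longlonglongrightarrow> (xstar, ystar)"
  shows "weak_d_stationary c X Y g h lam1 lam2 \<mu> (xstar, ystar)"
proof -
  obtain L where lip: "L-lipschitz_on UNIV c"
    using c_lipschitz by blast
  then have lip_neg: "L-lipschitz_on UNIV (\<lambda>z. - c z)"
    by simp
  obtain r where r: "strict_mono r" and "((\<lambda>k. (xs k, ys k)) \<circ> r) \<longlonglongrightarrow> (xstar, ystar)"
    using accumulation by blast
  then have x: "(\<lambda>k. xs (r k)) \<longlonglongrightarrow> xstar" and y: "(\<lambda>k. ys (r k)) \<longlonglongrightarrow> ystar"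
    by (auto simp: o_def dest: tendsto_fst tendsto_snd)
  have eps: "\<epsilon> (r k) \<in> {0<..1}" for k
    by (rule eps_range)
  have eps_lim: "(\<lambda>k. \<epsilon> (r k)) \<longlonglongrightarrow> 0"
    using LIMSEQ_subseq_LIMSEQ[OF eps_tendsto r] by (simp add: o_def)
  have closed: "closed X" "closed Y"
    unfolding X_def Y_def using u_lipschitz v_lipschitz by (auto intro: closed_box_constraints)
  let ?C = "\<lambda>k. mollify c \<psi> (\<epsilon> (r k))"

  have mem: "xs (r k) \<in> X" "ys (r k) \<in> Y"
    and ex: "\<exists>q p. (\<forall>a. q a \<in> active_pieces (g a (xs (r k) $ coord a) - \<mu>)) \<and>
      (\<forall>b. p b \<in> active_pieces (h b (ys (r k) $ coord b) - \<mu>)) \<and>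
      stationarity_inclusion (clarke_subdiff (\<lambda>x. ?C k (x, ys (r k))) (xs (r k)))
        X g lam1 \<mu> q (xs (r k)) \<and>
      stationarity_inclusion (clarke_subdiff (\<lambda>y. - ?C k (xs (r k), y)) (ys (r k)))
        Y h lam2 \<mu> p (ys (r k))" for k
    using stationary[of "r k"] unfolding weak_d_stationary_def clarke_subdiff_uminus by auto
  from ex obtain q p where
    q: "\<And>k a. q k a \<in> active_pieces (g a (xs (r k) $ coord a) - \<mu>)" and
    p: "\<And>k b. p k b \<in> active_pieces (h b (ys (r k) $ coord b) - \<mu>)" and
    incl_x: "\<And>k. stationarity_inclusion (clarke_subdiff (\<lambda>x. ?C k (x, ys (r k))) (xs (r k)))
        X g lam1 \<mu> (q k) (xs (r k))" and
    incl_y: "\<And>k. stationarity_inclusion (clarke_subdiff (\<lambda>y. - ?C k (xs (r k), y)) (ys (r k)))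
        Y h lam2 \<mu> (p k) (ys (r k))"
    by metis

  have "\<exists>q. (\<forall>a. q a \<in> active_pieces (g a (xstar $ coord a) - \<mu>)) \<and>
      stationarity_inclusion (clarke_subdiff (\<lambda>x. c (x, ystar)) xstar) X g lam1 \<mu> q xstar"
  proof (rule stationarity_inclusion_limit[OF _ _ _ g_C1 closed(1) x q incl_x])
    fix k
    show "convex_on UNIV (\<lambda>x. ?C k (x, ys (r k)))"
    proof (rule mollify_convex_along[OF mollifiers eps lip])
      fix w :: "(real^'n) \<times> (real^'m)"
      show "convex_on UNIV (\<lambda>x. c ((x, ys (r k)) - w))"
        using convex_on_translate[OF c_convex[of "ys (r k) - snd w"], of "fst w"]
        by (cases w) simp
    qed
    show "L-lipschitz_on UNIV (\<lambda>x. ?C k (x, ys (r k)))"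
      by (intro lipschitz_on_Pair_slices mollify_lipschitz[OF mollifiers eps lip])
  next
    show "(\<lambda>k. ?C k (z, ys (r k))) \<longlonglongrightarrow> c (z, ystar)" for z
      by (intro mollify_tendsto[OF mollifiers lip eps eps_lim] tendsto_Pair tendsto_const y)
  qed
  (* In the second block the concave function enters through its convex negative; its sign is
     absorbed by the mollification, which is linear in c. *)
  moreover have "\<exists>p. (\<forall>b. p b \<in> active_pieces (h b (ystar $ coord b) - \<mu>)) \<and>
      stationarity_inclusion (clarke_subdiff (\<lambda>y. - c (xstar, y)) ystar) Y h lam2 \<mu> p ystar"
  proof (rule stationarity_inclusion_limit[OF _ _ _ h_C1 closed(2) y p incl_y])
    fix k
    have "convex_on UNIV (\<lambda>y. mollify (\<lambda>z. - c z) \<psi> (\<epsilon> (r k)) (xs (r k), y))"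
    proof (rule mollify_convex_along[OF mollifiers eps lip_neg])
      fix w :: "(real^'n) \<times> (real^'m)"
      have "convex_on UNIV (\<lambda>y. - c (xs (r k) - fst w, y))"
        using c_concave by (simp add: concave_on_def)
      from convex_on_translate[OF this, of "snd w"]
      show "convex_on UNIV (\<lambda>y. - c ((xs (r k), y) - w))"
        by (cases w) simp
    qed
    then show "convex_on UNIV (\<lambda>y. - ?C k (xs (r k), y))"
      by (simp add: mollify_uminus)
    have "L-lipschitz_on UNIV (\<lambda>y. ?C k (xs (r k), y))"
      by (intro lipschitz_on_Pair_slices mollify_lipschitz[OF mollifiers eps lip])
    then show "L-lipschitz_on UNIV (\<lambda>y. - ?C k (xs (r k), y))"
      by simp
  next
    show "(\<lambda>k. - ?C k (xs (r k), z)) \<longlonglongrightarrow> - c (xstar, z)" for z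
      by (intro tendsto_minus mollify_tendsto[OF mollifiers lip eps eps_lim]
          tendsto_Pair tendsto_const x)
  qed
  moreover have "xstar \<in> X" "ystar \<in> Y"
    using closed_sequentially[OF closed(1) _ x] closed_sequentially[OF closed(2) _ y] mem by auto
  ultimately show ?thesis
    unfolding weak_d_stationary_def clarke_subdiff_uminus by auto
qed

end
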